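(* In every digraph $G=(V,A)$ with $V\neq\emptyset$ there exists a node $t\in V$ such that $\varrho_G(Z)\ge \mu(G)/2$ for every non-empty $Z\subseteq V\setminus\{t\}$.
   Context: $\varrho_G(Z)$ denotes the number of arcs of $G$ entering $Z$. $\mu(G)=\min\{\varrho_G(Z_1)+\varrho_G(Z_2): Z_1,Z_2\subsetneq V \text{ non-empty},\ Z_1\cap Z_2=\emptyset\}$ is the minimum cardinality of a double cut (with $\min\emptyset=+\infty$). *)

theory Defs
  imports "Graph_Theory.Digraph" "HOL-Library.Extended_Real"
begin

definition entering_arcs :: "('a, 'b) pre_digraph \<Rightarrow> 'a set \<Rightarrow> 'b set" where
  "entering_arcs G Z = {e \<in> arcs G. tail G e \<notin> Z \<and> head G e \<in> Z}"

definition set_in_degree :: "('a, 'b) pre_digraph \<Rightarrow> 'a set \<Rightarrow> nat" where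
  "set_in_degree G Z = card (entering_arcs G Z)"

definition double_cut_pairs :: "('a, 'b) pre_digraph \<Rightarrow> ('a set \<times> 'a set) set" where
  "double_cut_pairs G =
     {(Z\<^sub>1, Z\<^sub>2). Z\<^sub>1 \<noteq> {} \<and> Z\<^sub>2 \<noteq> {} \<and> Z\<^sub>1 \<subset> verts G \<and> Z\<^sub>2 \<subset> verts G \<and> Z\<^sub>1 \<inter> Z\<^sub>2 = {}}"

(* On enat the infimum of a non-empty set is attained, so it is a minimum; the infimum of
   the empty set (no admissible pair, i.e. at most one vertex) is infinity. *)
definition min_double_cut :: "('a, 'b) pre_digraph \<Rightarrow> enat" where
  "min_double_cut G =
     (INF (Z\<^sub>1, Z\<^sub>2) \<in> double_cut_pairs G. enat (set_in_degree G Z\<^sub>1 + set_in_degree G Z\<^sub>2))"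

end

theory Submission
  imports Defs
begin

text \<open>
  Call a non-empty proper subset of the vertices small if its in-degree is below \<open>\<mu>/2\<close>; the claim
  is that the small sets have a common vertex. Otherwise take an inclusion-minimal
  family \<open>F\<close> of small sets with empty intersection. By minimality the sets
  \<open>W Z = \<Inter>(F - {Z})\<close> are non-empty, and they are pairwise disjoint, so any two
  of them form a double cut and their in-degrees sum to at least \<open>|F| \<mu>/2\<close>. But an arc enters at most
  one \<open>W Z\<close>, and if it does, it enters some member of \<open>F\<close>; hence the in-degrees of the members
  of \<open>F\<close> sum to at least \<open>|F| \<mu>/2\<close> as well, contradicting smallness.
\<close>

text \<open>Double counting: summed over all ordered pairs of distinct indices, each
  \<open>a i\<close> occurs \<open>2 * (card F - 1)\<close> times. The common factor
  \<open>card F - 1\<close> is positive and cancels.\<close>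

lemma sum_ge_of_pairwise_ge:
  fixes a :: "'i \<Rightarrow> int"
  assumes "finite F" and "2 \<le> card F"
    and pair: "\<And>i j. i \<in> F \<Longrightarrow> j \<in> F \<Longrightarrow> i \<noteq> j \<Longrightarrow> m \<le> a i + a j"
  shows "int (card F) * m \<le> 2 * sum a F"
proof -
  let ?k = "int (card F)"
  have "m * (?k - 1) \<le> (?k - 2) * a i + sum a F" if "i \<in> F" for i
  proof -
    have card: "int (card (F - {i})) = ?k - 1"
      using that assms by (simp add: of_nat_diff)
    have "m * (?k - 1) = (\<Sum>j\<in>F - {i}. m)"
      using card by simp
    also have "\<dots> \<le> (\<Sum>j\<in>F - {i}. a i + a j)"
      using pair that by (intro sum_mono) auto
    also have "\<dots> = (?k - 1) * a i + (sum a F - a i)"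
      using that \<open>finite F\<close> card by (simp add: sum.distrib sum_diff1)
    finally show ?thesis
      by (simp add: algebra_simps)
  qed
  then have "(\<Sum>i\<in>F. m * (?k - 1)) \<le> (\<Sum>i\<in>F. (?k - 2) * a i + sum a F)"
    by (rule sum_mono)
  then have "(?k - 1) * (?k * m) \<le> (?k - 1) * (2 * sum a F)"
    by (simp add: sum.distrib flip: sum_distrib_left) (simp add: algebra_simps)
  then show ?thesis
    using assms(2) by (simp only: mult_le_cancel_left_pos[of "?k - 1"])
qed

text \<open>An arc has a single head, so disjoint sets are entered by different arcs and the left
  sum is the size of a union; the union bound gives the rest.\<close>

lemma (in fin_digraph) sum_set_in_degree_le:
  assumes "finite F"
    and disj: "\<And>X Y. X \<in> F \<Longrightarrow> Y \<in> F \<Longrightarrow> X \<noteq> Y \<Longrightarrow> W X \<inter> W Y = {}"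
    and enter: "\<And>X. X \<in> F \<Longrightarrow> entering_arcs G (W X) \<subseteq> (\<Union>Z\<in>F. entering_arcs G Z)"
  shows "(\<Sum>X\<in>F. set_in_degree G (W X)) \<le> (\<Sum>X\<in>F. set_in_degree G X)"
proof -
  have fin: "finite (entering_arcs G Z)" for Z
    by (simp add: entering_arcs_def)
  have "(\<Sum>X\<in>F. set_in_degree G (W X)) = card (\<Union>X\<in>F. entering_arcs G (W X))"
    unfolding set_in_degree_def
  proof (rule card_UN_disjoint[symmetric])
    show "\<forall>X\<in>F. \<forall>Y\<in>F. X \<noteq> Y \<longrightarrow> entering_arcs G (W X) \<inter> entering_arcs G (W Y) = {}"
      using disj by (fastforce simp: entering_arcs_def)
  qed (use fin \<open>finite F\<close> in auto)
  also have "\<dots> \<le> card (\<Union>X\<in>F. entering_arcs G X)"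
    using enter fin \<open>finite F\<close> by (intro card_mono) auto
  also have "\<dots> \<le> (\<Sum>X\<in>F. set_in_degree G X)"
    unfolding set_in_degree_def by (rule card_UN_le[OF \<open>finite F\<close>])
  finally show ?thesis .
qed

lemma (in fin_digraph) small_sets_common_vertex:
  assumes "finite F" and "verts G \<noteq> {}"
    and cut: "\<And>X Y. (X, Y) \<in> double_cut_pairs G \<Longrightarrow> m \<le> set_in_degree G X + set_in_degree G Y"
    and F: "\<And>Z. Z \<in> F \<Longrightarrow> Z \<noteq> {} \<and> Z \<subset> verts G \<and> 2 * set_in_degree G Z < m"
  shows "verts G \<inter> \<Inter>F \<noteq> {}"
  using \<open>finite F\<close> F
proof (induction F rule: finite_psubset_induct)
  case (psubset F)
  show ?case
  proof
    assume empty: "verts G \<inter> \<Inter>F = {}"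
    define W where "W Z = verts G \<inter> \<Inter>(F - {Z})" for Z
    \<comment> \<open>Strong induction stands in for minimality: the hypothesis applies to the
      proper subfamily \<open>F - {Z}\<close>.\<close>
    have W_nonempty: "W Z \<noteq> {}" if "Z \<in> F" for Z
      unfolding W_def using that psubset.prems by (intro psubset.IH) auto
    \<comment> \<open>\<open>F - {X}\<close> and \<open>F - {Y}\<close> together cover
      \<open>F\<close>, so a shared vertex would lie in every member of \<open>F\<close>.\<close>
    have W_disjoint: "W X \<inter> W Y = {}" if "X \<noteq> Y" for X Y
      using that empty unfolding W_def by blast
    have W_subset: "W X \<subseteq> Y" if "Y \<in> F" "X \<noteq> Y" for X Y
      using that unfolding W_def by blast
    have "F \<noteq> {}"
      using empty \<open>verts G \<noteq> {}\<close> by auto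
    moreover have "F \<noteq> {Z}" for Z
      using empty psubset.prems by blast
    ultimately have card: "2 \<le> card F"
      using \<open>finite F\<close> card_1_singletonE[of F] card_0_eq[of F]
      by (metis One_nat_def Suc_1 less_Suc0 linorder_not_less not_less_eq_eq le_antisym)
    have pair: "int m \<le> int (set_in_degree G (W X)) + int (set_in_degree G (W Y))"
      if "X \<in> F" "Y \<in> F" "X \<noteq> Y" for X Y
    proof -
      have "W X \<subset> verts G" "W Y \<subset> verts G"
        using W_subset[of Y X] W_subset[of X Y] that psubset.prems by blast+
      then have "(W X, W Y) \<in> double_cut_pairs G"
        using that W_nonempty W_disjoint by (simp add: double_cut_pairs_def)
      from cut[OF this] show ?thesis by simp
    qed
    \<comment> \<open>The tail is a vertex outside \<open>W X\<close>, so it misses some member of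
      \<open>F - {X}\<close>; the head lies in all of them.\<close>
    have "entering_arcs G (W X) \<subseteq> (\<Union>Z\<in>F. entering_arcs G Z)" for X
      using wf_digraph unfolding entering_arcs_def W_def by auto
    then have "(\<Sum>X\<in>F. set_in_degree G (W X)) \<le> (\<Sum>X\<in>F. set_in_degree G X)"
      using \<open>finite F\<close> W_disjoint by (intro sum_set_in_degree_le) auto
    moreover have "card F * m \<le> 2 * (\<Sum>X\<in>F. set_in_degree G (W X))"
    proof -
      have "int (card F) * int m \<le> 2 * (\<Sum>X\<in>F. int (set_in_degree G (W X)))"
        by (rule sum_ge_of_pairwise_ge[OF \<open>finite F\<close> card pair])
      then have "int (card F * m) \<le> int (2 * (\<Sum>X\<in>F. set_in_degree G (W X)))"
        by simp
      then show ?thesis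
        by (simp only: of_nat_le_iff)
    qed
    moreover have "(\<Sum>X\<in>F. 2 * set_in_degree G X) < (\<Sum>X\<in>F. m)"
      using \<open>finite F\<close> \<open>F \<noteq> {}\<close> psubset.prems by (intro sum_strict_mono) auto
    ultimately show False
      by (simp flip: sum_distrib_left)
  qed
qed

theorem theorem4:
  fixes G :: "('a, 'b) pre_digraph"
  assumes "fin_digraph G"
    and "verts G \<noteq> {}"
  shows "\<exists>t \<in> verts G. \<forall>Z. Z \<noteq> {} \<and> Z \<subseteq> verts G - {t} \<longrightarrow>
           ereal (real (set_in_degree G Z)) \<ge> ereal_of_enat (min_double_cut G) / 2"
proof -
  interpret fin_digraph G by fact
  have le: "min_double_cut G \<le> enat (set_in_degree G X + set_in_degree G Y)"
    if "(X, Y) \<in> double_cut_pairs G" for X Y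
    unfolding min_double_cut_def using that by (intro INF_lower2[of "(X, Y)"]) auto
  show ?thesis
  proof (cases "min_double_cut G")
    case (enat m)
    define F where "F = {Z. Z \<noteq> {} \<and> Z \<subset> verts G \<and> 2 * set_in_degree G Z < m}"
    have "finite F"
      unfolding F_def by (rule finite_subset[of _ "Pow (verts G)"]) auto
    then have "verts G \<inter> \<Inter>F \<noteq> {}"
      using le enat \<open>verts G \<noteq> {}\<close> by (intro small_sets_common_vertex[of _ m]) (auto simp: F_def)
    then obtain t where t: "t \<in> verts G" "\<And>Z. Z \<in> F \<Longrightarrow> t \<in> Z"
      by blast
    show ?thesis
    proof (intro bexI[of _ t] allI impI)
      fix Z assume Z: "Z \<noteq> {} \<and> Z \<subseteq> verts G - {t}"
      then have "Z \<notin> F"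
        using t(2) by blast
      \<comment> \<open>Since \<open>Z\<close> misses \<open>t\<close>, it is a proper subset, so
        only its in-degree can keep it out of \<open>F\<close>.\<close>
      then have "m \<le> 2 * set_in_degree G Z"
        using Z t(1) unfolding F_def by auto
      then have "real m / 2 \<le> real (set_in_degree G Z)"
        by linarith
      moreover have "ereal_of_enat (min_double_cut G) / 2 = ereal (real m / 2)"
        using enat by simp
      ultimately show "ereal_of_enat (min_double_cut G) / 2 \<le> ereal (real (set_in_degree G Z))"
        by simp
    qed (rule t(1))
  next
    case infinity
    obtain t where t: "t \<in> verts G"
      using \<open>verts G \<noteq> {}\<close> by blast
    \<comment> \<open>A non-empty \<open>Z\<close> avoiding \<open>t\<close> would form with
      \<open>{t}\<close> a double cut of finite value, so the claim is vacuous here.\<close>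
    have "Z = {}" if "Z \<subseteq> verts G - {t}" for Z
    proof (rule ccontr)
      assume "Z \<noteq> {}"
      with that t have "(Z, {t}) \<in> double_cut_pairs G"
        by (auto simp: double_cut_pairs_def)
      from le[OF this] infinity show False by simp
    qed
    with t show ?thesis by blast
  qed
qed

end
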